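(* If $G$ and $H$ are graphs which both admit nontrivial path covers, then the outcome of the Maker-Breaker domination game on $G \square H$ is $\mathcal{D}$, i.e., Dominator has a winning strategy both in the D-game and in the S-game on $G \square H$.
   Context: A path cover of a graph $G$ is a set of pairwise vertex-disjoint paths (subgraphs of $G$) covering $V(G)$; it is nontrivial if every path in it has at least one edge. The Maker-Breaker domination game on a finite graph $G$ is played by Dominator and Staller, who alternately claim a previously unplayed vertex of $G$ until all vertices are played. Dominator wins if his claimed vertices form a dominating set of $G$; otherwise Staller wins (equivalently, Staller claims all vertices of some closed neighborhood $N_G[v]$). The D-game is the game where Dominator moves first, the S-game where Staller moves first. The outcome is $\mathcal{D}$ if Dominator has a winning strategy in both the D-game and the S-game. $G\square H$ is the Cartesian product: vertex set $V(G)\times V(H)$, $(g,h)\sim(g',h')$ iff either $gg'\in E(G)$ and $h=h'$, or $g=g'$ and $hh'\in E(H)$. *)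

theory Defs
  imports
    "Graph_Theory.Pair_Digraph"
    "Graph_Theory.Digraph_Component"
    "Graph_Theory.Vertex_Walk"
begin

text \<open>Finite simple graphs are \<^locale>\<open>pair_graph\<close>s: an undirected edge is a pair of opposite arcs.\<close>

text \<open>
  A path is a graph, not a vertex sequence: the two traversals of a path give the same object.
  Single vertices count as (trivial) paths.
\<close>

definition is_path :: "'a pair_pre_digraph \<Rightarrow> bool" where
  "is_path P \<longleftrightarrow> (\<exists>p. p \<noteq> [] \<and> distinct p \<and> pverts P = set p \<and>
     parcs P = set (vwalk_arcs p) \<union> (set (vwalk_arcs p))\<inverse>)"

definition path_cover :: "'a pair_pre_digraph \<Rightarrow> 'a pair_pre_digraph set \<Rightarrow> bool" where
  "path_cover G C \<longleftrightarrow>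
     (\<forall>P\<in>C. is_path P \<and> subgraph (with_proj P) (with_proj G)) \<and>
     (\<forall>P\<in>C. \<forall>Q\<in>C. P \<noteq> Q \<longrightarrow> pverts P \<inter> pverts Q = {}) \<and>
     (\<Union>P\<in>C. pverts P) = pverts G"

definition nontrivial_path_cover :: "'a pair_pre_digraph \<Rightarrow> 'a pair_pre_digraph set \<Rightarrow> bool" where
  "nontrivial_path_cover G C \<longleftrightarrow> path_cover G C \<and> (\<forall>P\<in>C. parcs P \<noteq> {})"

definition cart_prod :: "'a pair_pre_digraph \<Rightarrow> 'b pair_pre_digraph \<Rightarrow> ('a \<times> 'b) pair_pre_digraph"
    (infixr "\<box>" 70) where
  "G \<box> H = \<lparr> pverts = pverts G \<times> pverts H,
     parcs = {((g, h), (g', h')) | g h g' h'.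
       (g, g') \<in> parcs G \<and> h = h' \<and> h \<in> pverts H \<or>
       g = g' \<and> g \<in> pverts G \<and> (h, h') \<in> parcs H} \<rparr>"

lemma pair_graph_cart_prod:
  assumes "pair_graph G" and "pair_graph H"
  shows "pair_graph (G \<box> H)"
proof -
  interpret G: pair_graph G by fact
  interpret H: pair_graph H by fact
  have sub: "parcs (G \<box> H) \<subseteq> (pverts G \<times> pverts H) \<times> (pverts G \<times> pverts H)"
    by (auto simp: cart_prod_def dest: G.wellformed' H.wellformed')
  have fin: "finite (parcs (G \<box> H))"
    by (rule finite_subset[OF sub]) (simp add: G.pair_finite_verts H.pair_finite_verts)
  have symG: "(b, a) \<in> parcs G" if "(a, b) \<in> parcs G" for a b
    using G.pair_sym_arcs that by (auto simp: symmetric_def dest: symD)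
  have symH: "(b, a) \<in> parcs H" if "(a, b) \<in> parcs H" for a b
    using H.pair_sym_arcs that by (auto simp: symmetric_def dest: symD)
  show ?thesis
  proof
    show "fst e \<in> pverts (G \<box> H)" "snd e \<in> pverts (G \<box> H)" if "e \<in> parcs (G \<box> H)" for e
      using sub that by (auto simp: cart_prod_def dest: G.wellformed' H.wellformed')
    show "finite (pverts (G \<box> H))"
      by (simp add: cart_prod_def G.pair_finite_verts H.pair_finite_verts)
    show "finite (parcs (G \<box> H))" by (fact fin)
    show "fst e \<noteq> snd e" if "e \<in> parcs (G \<box> H)" for e
      using that by (auto simp: cart_prod_def dest: G.pair_no_loops H.pair_no_loops)
    show "symmetric (with_proj (G \<box> H))"
      unfolding symmetric_def by (rule symI) (auto simp: cart_prod_def intro: symG symH)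
  qed
qed

definition dominating_set :: "'a pair_pre_digraph \<Rightarrow> 'a set \<Rightarrow> bool" where
  "dominating_set G S \<longleftrightarrow>
     S \<subseteq> pverts G \<and> (\<forall>v \<in> pverts G - S. \<exists>u \<in> S. (u, v) \<in> parcs G)"

datatype player = Dominator | Staller

fun opponent :: "player \<Rightarrow> player" where
  "opponent Dominator = Staller"
| "opponent Staller = Dominator"

text \<open>
  A play is recorded as the list of the vertices played so far, in order;
  \<open>mover s i\<close> is the player making move number \<open>i\<close> (counted from \<open>0\<close>) if \<open>s\<close> moves first.
\<close>

definition play :: "'a pair_pre_digraph \<Rightarrow> 'a list \<Rightarrow> bool" where
  "play G p \<longleftrightarrow> distinct p \<and> set p \<subseteq> pverts G"

definition complete_play :: "'a pair_pre_digraph \<Rightarrow> 'a list \<Rightarrow> bool" where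
  "complete_play G p \<longleftrightarrow> distinct p \<and> set p = pverts G"

definition mover :: "player \<Rightarrow> nat \<Rightarrow> player" where
  "mover s i = (if even i then s else opponent s)"

definition claimed :: "player \<Rightarrow> player \<Rightarrow> 'a list \<Rightarrow> 'a set" where
  "claimed s X p = {p ! i | i. i < length p \<and> mover s i = X}"

text \<open>A strategy maps the history of the play to the next vertex to be played.\<close>

type_synonym 'a strategy = "'a list \<Rightarrow> 'a"

definition consistent :: "player \<Rightarrow> player \<Rightarrow> 'a strategy \<Rightarrow> 'a list \<Rightarrow> bool" where
  "consistent s X \<sigma> p \<longleftrightarrow> (\<forall>i < length p. mover s i = X \<longrightarrow> p ! i = \<sigma> (take i p))"

definition valid_strategy ::
    "'a pair_pre_digraph \<Rightarrow> player \<Rightarrow> player \<Rightarrow> 'a strategy \<Rightarrow> bool" where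
  "valid_strategy G s X \<sigma> \<longleftrightarrow>
     (\<forall>p. play G p \<and> \<not> complete_play G p \<and> consistent s X \<sigma> p \<and> mover s (length p) = X
        \<longrightarrow> \<sigma> p \<in> pverts G - set p)"

definition dominator_wins :: "'a pair_pre_digraph \<Rightarrow> player \<Rightarrow> bool" where
  "dominator_wins G s \<longleftrightarrow>
     (\<exists>\<sigma>. valid_strategy G s Dominator \<sigma> \<and>
        (\<forall>p. complete_play G p \<and> consistent s Dominator \<sigma> p
           \<longrightarrow> dominating_set G (claimed s Dominator p)))"

text \<open>The D-game is the game with \<open>s = Dominator\<close>, the S-game the one with \<open>s = Staller\<close>.\<close>

definition outcome_D :: "'a pair_pre_digraph \<Rightarrow> bool" where
  "outcome_D G \<longleftrightarrow> dominator_wins G Dominator \<and> dominator_wins G Staller"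

end

theory Submission
  imports Defs
begin

text \<open>
  Cutting every path of the two covers into paths on two or three vertices splits the vertex set of
  the product into grids \<open>2 \<times> 2\<close>, \<open>2 \<times> 3\<close> and \<open>3 \<times> 3\<close>. Dominator answers in the grid in which
  Staller has just played, so it suffices that he wins as the second player on each grid. A grid
  with an even side has a perfect matching, and he always takes the partner of Staller's vertex. The
  \<open>3 \<times> 3\<close> grid admits no such pairing from the start, but after each first move of Staller there is
  a reply of Dominator such that suitable pairs of the remaining vertices take care of every vertex
  not dominated by the reply. When no answer is called for, an extra move does no harm.
\<close>

section \<open>Second-player strategies\<close>

text \<open>
  \<open>guards N B T\<close>: playing second and only on the vertices of \<open>B\<close>, Dominator gets a vertex of
  \<open>N v\<close> for each \<open>v \<in> T\<close>.
\<close>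

inductive guards :: "('v \<Rightarrow> 'v set) \<Rightarrow> 'v set \<Rightarrow> 'v set \<Rightarrow> bool" for N where
  empty: "guards N {} {}"
| reply: "B \<noteq> {} \<Longrightarrow>
    (\<And>x. x \<in> B \<Longrightarrow> \<exists>y\<in>B - {x}. \<exists>B' T'. guards N B' T' \<and> B' \<subseteq> B - {x, y} \<and> T \<subseteq> {v. y \<in> N v} \<union> T')
    \<Longrightarrow> guards N B T"

lemma guardsE:
  assumes "guards N B T" "x \<in> B"
  obtains y B' T' where "y \<in> B" "y \<noteq> x" "guards N B' T'" "B' \<subseteq> B - {x, y}"
    "T \<subseteq> {v. y \<in> N v} \<union> T'"
  using assms(1)
proof cases
  case empty
  then show ?thesis using assms(2) by simp
next
  case reply
  from reply(2)[OF assms(2)] show ?thesis using that by blast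
qed

text \<open>Rests on the premise \<open>B \<noteq> {}\<close> of \<open>reply\<close>: on an empty
  board its other premise would be vacuous and would admit every \<open>T\<close>.\<close>

lemma guards_empty_board: "guards N {} T \<Longrightarrow> T = {}"
  by (erule guards.cases) auto

text \<open>Dominator answers on the board where Staller has just played, so each round advances
  only one of the two games. Hence the nested inductions: the outer one, with \<open>B2\<close> and
  \<open>T2\<close> arbitrary, handles a move in \<open>B1\<close>; the inner one, with
  \<open>B1\<close> fixed, a move in \<open>B2\<close>.\<close>

lemma guards_Un:
  assumes "guards N B1 T1" "guards N B2 T2" "B1 \<inter> B2 = {}"
  shows "guards N (B1 \<union> B2) (T1 \<union> T2)"
  using assms
proof (induction arbitrary: B2 T2 rule: guards.induct)
  case empty
  then show ?case by simp
next
  case outer: (reply B1 T1)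
  have gB1: "guards N B1 T1"
    using outer.hyps by (rule guards.reply) (use outer.IH in fast)
  show ?case
    using outer.prems
  proof (induction rule: guards.induct)
    case empty
    show ?case using gB1 by simp
  next
    case inner: (reply B2 T2)
    have gB2: "guards N B2 T2"
      using inner.hyps by (rule guards.reply) (use inner.IH in fast)
    show ?case
    proof (rule guards.reply)
      fix x assume "x \<in> B1 \<union> B2"
      then consider "x \<in> B1" | "x \<in> B2" by blast
      then show "\<exists>y\<in>B1 \<union> B2 - {x}. \<exists>B' T'. guards N B' T' \<and> B' \<subseteq> B1 \<union> B2 - {x, y} \<and>
          T1 \<union> T2 \<subseteq> {v. y \<in> N v} \<union> T'"
      proof cases
        case 1
        from outer.IH[OF 1] obtain y B' T' where y: "y \<in> B1 - {x}" "B' \<subseteq> B1 - {x, y}"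
          "T1 \<subseteq> {v. y \<in> N v} \<union> T'"
          and IH: "\<And>B2 T2. guards N B2 T2 \<Longrightarrow> B' \<inter> B2 = {} \<Longrightarrow> guards N (B' \<union> B2) (T' \<union> T2)"
          by blast
        have "guards N (B' \<union> B2) (T' \<union> T2)"
          using IH[OF gB2] y inner.prems by blast
        moreover have "B' \<union> B2 \<subseteq> B1 \<union> B2 - {x, y}"
          using y inner.prems 1 by blast
        moreover have "T1 \<union> T2 \<subseteq> {v. y \<in> N v} \<union> (T' \<union> T2)"
          using y by blast
        ultimately show ?thesis using y by blast
      next
        case 2
        from inner.IH[OF 2] obtain y B' T' where y: "y \<in> B2 - {x}" "B' \<subseteq> B2 - {x, y}"
          "T2 \<subseteq> {v. y \<in> N v} \<union> T'"
          and IH: "B1 \<inter> B' = {} \<Longrightarrow> guards N (B1 \<union> B') (T1 \<union> T')"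
          by blast
        have "guards N (B1 \<union> B') (T1 \<union> T')"
          using IH y inner.prems by blast
        moreover have "B1 \<union> B' \<subseteq> B1 \<union> B2 - {x, y}"
          using y inner.prems 2 by blast
        moreover have "T1 \<union> T2 \<subseteq> {v. y \<in> N v} \<union> (T1 \<union> T')"
          using y by blast
        ultimately show ?thesis using y by blast
      qed
    qed (use outer.hyps in blast)
  qed
qed

lemma guards_mono_targets:
  assumes "guards N B T" "T' \<subseteq> T"
  shows "guards N B T'"
proof (cases "B = {}")
  case True
  then show ?thesis using assms guards_empty_board guards.empty by fastforce
next
  case False
  then show ?thesis
  proof (rule guards.reply)
    fix x assume "x \<in> B"
    with assms(1) obtain y B1 T1 where "y \<in> B" "y \<noteq> x" "guards N B1 T1" "B1 \<subseteq> B - {x, y}"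
      "T \<subseteq> {v. y \<in> N v} \<union> T1" by (rule guardsE)
    moreover from this(5) assms(2) have "T' \<subseteq> {v. y \<in> N v} \<union> T1" by (rule subset_trans[rotated])
    ultimately show "\<exists>y\<in>B - {x}. \<exists>B1 T1. guards N B1 T1 \<and> B1 \<subseteq> B - {x, y} \<and>
      T' \<subseteq> {v. y \<in> N v} \<union> T1" by blast
  qed
qed

text \<open>Pairing: whichever of \<open>a\<close>, \<open>b\<close> Staller takes, Dominator takes
  the other.\<close>

lemma guards_pair:
  assumes "a \<noteq> b"
  shows "guards N {a, b} {v. a \<in> N v \<and> b \<in> N v}"
proof (rule guards.reply)
  fix x assume x: "x \<in> {a, b}"
  define y where "y = (if x = a then b else a)"
  have "y \<in> {a, b} - {x}" "{v. a \<in> N v \<and> b \<in> N v} \<subseteq> {v. y \<in> N v} \<union> {}"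
    using assms x by (auto simp: y_def)
  then show "\<exists>y\<in>{a, b} - {x}. \<exists>B' T'. guards N B' T' \<and> B' \<subseteq> {a, b} - {x, y} \<and>
      {v. a \<in> N v \<and> b \<in> N v} \<subseteq> {v. y \<in> N v} \<union> T'"
    using guards.empty by blast
qed simp

text \<open>For closed neighbourhoods this applies to adjacent \<open>a\<close> and
  \<open>b\<close>: one edge of a perfect matching.\<close>

lemma guards_edge:
  assumes "a \<noteq> b" "{a, b} \<subseteq> N a" "{a, b} \<subseteq> N b"
  shows "guards N {a, b} {a, b}"
  by (rule guards_mono_targets[OF guards_pair]) (use assms in auto)

lemma guards_three_pairs:
  assumes "distinct [a, a', b, b', c, c']"
  shows "guards N {a, a', b, b', c, c'}
    ({v. a \<in> N v \<and> a' \<in> N v} \<union> {v. b \<in> N v \<and> b' \<in> N v} \<union> {v. c \<in> N v \<and> c' \<in> N v})"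
proof -
  have "guards N (({a, a'} \<union> {b, b'}) \<union> {c, c'})
    ({v. a \<in> N v \<and> a' \<in> N v} \<union> {v. b \<in> N v \<and> b' \<in> N v} \<union> {v. c \<in> N v \<and> c' \<in> N v})"
    using assms by (intro guards_Un guards_pair) auto
  moreover have "({a, a'} \<union> {b, b'}) \<union> {c, c'} = {a, a', b, b', c, c'}" by blast
  ultimately show ?thesis by simp
qed

text \<open>After the reply \<open>y\<close> to \<open>x\<close>, Dominator follows the pairing
  strategy on three disjoint pairs. On a nine-vertex board this leaves one vertex over, which is
  dropped from the board.\<close>

lemma guards_answer:
  assumes "distinct [x, y, a, a', b, b', c, c']" "{x, y, a, a', b, b', c, c'} \<subseteq> B"
    "\<forall>v\<in>B. y \<in> N v \<or> a \<in> N v \<and> a' \<in> N v \<or> b \<in> N v \<and> b' \<in> N v \<or> c \<in> N v \<and> c' \<in> N v"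
  shows "\<exists>y\<in>B - {x}. \<exists>B' T'. guards N B' T' \<and> B' \<subseteq> B - {x, y} \<and>
    B \<subseteq> {v. y \<in> N v} \<union> T'"
proof (intro bexI exI conjI)
  show "guards N {a, a', b, b', c, c'}
    ({v. a \<in> N v \<and> a' \<in> N v} \<union> {v. b \<in> N v \<and> b' \<in> N v} \<union> {v. c \<in> N v \<and> c' \<in> N v})"
    using assms(1) by (intro guards_three_pairs) simp
  show "{a, a', b, b', c, c'} \<subseteq> B - {x, y}" "y \<in> B - {x}"
    using assms(1,2) by auto
  show "B \<subseteq> {v. y \<in> N v} \<union>
    ({v. a \<in> N v \<and> a' \<in> N v} \<union> {v. b \<in> N v \<and> b' \<in> N v} \<union> {v. c \<in> N v \<and> c' \<in> N v})"
    using assms(3) by blast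
qed

text \<open>
  The vertices are numbered row by row. By symmetry only the first moves \<open>1\<close> (corner), \<open>2\<close> (side)
  and \<open>5\<close> (centre) matter; replies and pairs are \<open>1, 5 \<mapsto> 2\<close> with \<open>47, 89, 36\<close>, and
  \<open>2 \<mapsto> 4\<close> with \<open>36, 15, 89\<close>.
\<close>

lemma guards_grid_3x3:
  assumes dist: "distinct [v1, v2, v3, v4, v5, v6, v7, v8, v9]"
    and N: "{v1, v2, v4} \<subseteq> N v1" "{v1, v2, v3, v5} \<subseteq> N v2" "{v2, v3, v6} \<subseteq> N v3"
      "{v1, v4, v5, v7} \<subseteq> N v4" "{v2, v4, v5, v6, v8} \<subseteq> N v5" "{v3, v5, v6, v9} \<subseteq> N v6"
      "{v4, v7, v8} \<subseteq> N v7" "{v5, v7, v8, v9} \<subseteq> N v8" "{v6, v8, v9} \<subseteq> N v9"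
  shows "guards N {v1, v2, v3, v4, v5, v6, v7, v8, v9} {v1, v2, v3, v4, v5, v6, v7, v8, v9}"
    (is "guards N ?B ?B")
proof (rule guards.reply)
  \<comment> \<open>Reversing the list supplies each inequality to the simplifier in the other
    orientation.\<close>
  have dist': "distinct (rev [v1, v2, v3, v4, v5, v6, v7, v8, v9])"
    using dist by (simp only: distinct_rev)
  fix x assume "x \<in> ?B"
  then consider "x = v1" | "x = v2" | "x = v3" | "x = v4" | "x = v5" | "x = v6" | "x = v7"
    | "x = v8" | "x = v9" by blast
  then show "\<exists>y\<in>?B - {x}. \<exists>B' T'. guards N B' T' \<and> B' \<subseteq> ?B - {x, y} \<and> ?B \<subseteq> {v. y \<in> N v} \<union> T'"
  proof cases
    case 1
    \<comment> \<open>The reply 2 dominates 1, 2, 3, 5; the pairs see to 4 and 7, to 8 and 9, and to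
      6.\<close>
    show ?thesis by (rule guards_answer[of _ v2 v4 v7 v8 v9 v3 v6]) (use dist dist' N 1 in simp_all)
  next
    case 2
    \<comment> \<open>The reply 4 dominates 1, 4, 5, 7; the pair 15 sees to their common neighbour
      2, the other two pairs to their own members.\<close>
    show ?thesis by (rule guards_answer[of _ v4 v3 v6 v1 v5 v8 v9]) (use dist dist' N 2 in simp_all)
  next
    case 3
    \<comment> \<open>The remaining cases follow by symmetries of the square: 3, 7 and 9 from 1, and
      4, 6 and 8 from 2.\<close>
    show ?thesis by (rule guards_answer[of _ v2 v6 v9 v8 v7 v1 v4]) (use dist dist' N 3 in simp_all)
  next
    case 4
    show ?thesis by (rule guards_answer[of _ v2 v7 v8 v1 v5 v6 v9]) (use dist dist' N 4 in simp_all)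
  next
    case 5
    show ?thesis by (rule guards_answer[of _ v2 v4 v7 v8 v9 v3 v6]) (use dist dist' N 5 in simp_all)
  next
    case 6
    show ?thesis by (rule guards_answer[of _ v2 v9 v8 v3 v5 v4 v7]) (use dist dist' N 6 in simp_all)
  next
    case 7
    show ?thesis by (rule guards_answer[of _ v8 v4 v1 v2 v3 v9 v6]) (use dist dist' N 7 in simp_all)
  next
    case 8
    show ?thesis by (rule guards_answer[of _ v4 v9 v6 v7 v5 v2 v3]) (use dist dist' N 8 in simp_all)
  next
    case 9
    show ?thesis by (rule guards_answer[of _ v8 v6 v3 v2 v1 v7 v4]) (use dist dist' N 9 in simp_all)
  qed
qed simp

section \<open>From guards to the domination game\<close>

text \<open>Positions with Staller to move; \<open>A\<close> is Dominator's set, \<open>U\<close> the set of free vertices.\<close>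

definition secure :: "('v \<Rightarrow> 'v set) \<Rightarrow> 'v set \<Rightarrow> 'v set \<Rightarrow> 'v set \<Rightarrow> bool" where
  "secure N V A U \<longleftrightarrow> (\<exists>B T. B \<subseteq> U \<and> guards N B T \<and> (\<forall>v\<in>V. v \<in> T \<or> N v \<inter> A \<noteq> {}))"

text \<open>The corresponding positions with Dominator to move.\<close>

definition answerable :: "('v \<Rightarrow> 'v set) \<Rightarrow> 'v set \<Rightarrow> 'v set \<Rightarrow> 'v set \<Rightarrow> bool" where
  "answerable N V A U \<longleftrightarrow>
     (if U = {} then secure N V A {} else \<exists>y\<in>U. secure N V (insert y A) (U - {y}))"

text \<open>An empty board guards no targets, so every vertex is already dominated. This is why
  \<open>answerable\<close> falls back on \<open>secure\<close> once the play is complete.\<close>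

lemma secure_emptyD: "secure N V A {} \<Longrightarrow> v \<in> V \<Longrightarrow> N v \<inter> A \<noteq> {}"
  unfolding secure_def using guards_empty_board by fastforce

text \<open>Here \<open>x\<close> stands for Staller's last move, which may lie in the guarded board
  \<open>B\<close> or outside it.\<close>

lemma answerable_if_guards:
  assumes "B \<subseteq> insert x U" "guards N B T" "\<forall>v\<in>V. v \<in> T \<or> N v \<inter> A \<noteq> {}"
  shows "answerable N V A U"
proof (cases "B = {}")
  case True
  then have hit: "\<forall>v\<in>V. N v \<inter> A \<noteq> {}"
    using assms(2,3) guards_empty_board by blast
  have secure: "secure N V A' W" if "A \<subseteq> A'" for A' W
    unfolding secure_def
  proof (intro exI conjI)
    show "guards N {} {}" by (rule guards.empty)
    show "\<forall>v\<in>V. v \<in> {} \<or> N v \<inter> A' \<noteq> {}" using hit that by blast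
  qed simp
  show ?thesis
  proof (cases "U = {}")
    case True
    then show ?thesis by (simp add: answerable_def secure)
  next
    case False
    then obtain y where "y \<in> U" by blast
    moreover have "secure N V (insert y A) (U - {y})" by (rule secure) blast
    ultimately show ?thesis by (auto simp: answerable_def)
  qed
next
  case False
  \<comment> \<open>If \<open>x\<close> is outside \<open>B\<close>, Dominator pretends that Staller
    has just played some \<open>z\<close> in \<open>B\<close> and answers that.\<close>
  then obtain z where z: "z \<in> B" "x \<in> B \<Longrightarrow> z = x" by blast
  from assms(2) z(1) obtain y B' T' where y: "y \<in> B" "y \<noteq> z" "guards N B' T'"
    "B' \<subseteq> B - {z, y}" "T \<subseteq> {v. y \<in> N v} \<union> T'" by (rule guardsE)
  have "y \<in> U" using y(1,2) assms(1) z(2) by blast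
  moreover have "secure N V (insert y A) (U - {y})"
    unfolding secure_def
  proof (intro exI conjI)
    show "B' \<subseteq> U - {y}" using y(4) assms(1) z(2) by blast
    show "guards N B' T'" by fact
    show "\<forall>v\<in>V. v \<in> T' \<or> N v \<inter> insert y A \<noteq> {}" using assms(3) y(5) by blast
  qed
  ultimately show ?thesis by (auto simp: answerable_def)
qed

text \<open>Having the move does not hurt Dominator; this starts the D-game.\<close>

lemma answerable_if_secure:
  assumes "secure N V A U"
  shows "answerable N V A U"
proof -
  from assms obtain B T where B: "B \<subseteq> U" "guards N B T" "\<forall>v\<in>V. v \<in> T \<or> N v \<inter> A \<noteq> {}"
    unfolding secure_def by blast
  from B(1) have "B \<subseteq> insert x U" for x by blast
  then show ?thesis using B(2,3) by (rule answerable_if_guards)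
qed

lemma answerable_after_move:
  assumes "secure N V A U"
  shows "answerable N V A (U - {x})"
proof -
  from assms obtain B T where "B \<subseteq> U" "guards N B T" "\<forall>v\<in>V. v \<in> T \<or> N v \<inter> A \<noteq> {}"
    unfolding secure_def by blast
  then show ?thesis
    by (intro answerable_if_guards[of B x]) auto
qed

lemma mover_Suc: "mover s (Suc i) = opponent (mover s i)"
  by (cases s) (auto simp: mover_def)

lemma claimed_snoc:
  "claimed s X (p @ [x]) = (if mover s (length p) = X then insert x (claimed s X p) else claimed s X p)"
proof -
  have image: "claimed s X q = (!) q ` {i. i < length q \<and> mover s i = X}" for q :: "'a list"
    unfolding claimed_def by blast
  have "{i. i < length (p @ [x]) \<and> mover s i = X} =
    (if mover s (length p) = X then {length p} else {}) \<union> {i. i < length p \<and> mover s i = X}"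
    by (auto simp: less_Suc_eq)
  moreover have "(!) (p @ [x]) ` {i. i < length p \<and> mover s i = X} = claimed s X p"
    unfolding image by (rule image_cong) (simp_all add: nth_append)
  ultimately show ?thesis
    unfolding image[of "p @ [x]"] by (simp add: image_Un)
qed

lemma consistent_snoc:
  "consistent s X \<sigma> (p @ [x]) \<longleftrightarrow>
     consistent s X \<sigma> p \<and> (mover s (length p) = X \<longrightarrow> x = \<sigma> p)"
  by (auto simp: consistent_def nth_append less_Suc_eq)

definition closed_nbhd :: "'v pair_pre_digraph \<Rightarrow> 'v \<Rightarrow> 'v set" where
  "closed_nbhd K v = {u. u = v \<or> (u, v) \<in> parcs K}"

text \<open>Dominator always restores \<open>secure\<close>. The invariant is \<open>secure\<close>
  when Staller is to move and \<open>answerable\<close> when Dominator is; on a complete play either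
  one gives domination. Since \<open>s\<close> is arbitrary, both games are covered.\<close>

lemma dominator_wins_if_guards:
  fixes K :: "'v pair_pre_digraph"
  assumes "guards (closed_nbhd K) (pverts K) (pverts K)"
  shows "dominator_wins K s"
proof -
  define N where "N = closed_nbhd K"
  define V where "V = pverts K"
  define keeps where "keeps p y \<longleftrightarrow> y \<in> V - set p \<and>
    secure N V (insert y (claimed s Dominator p)) (V - set p - {y})" for p y
  \<comment> \<open>The default keeps \<open>\<sigma>\<close> legal on every history that leaves a
    free vertex, so validity can be shown before the invariant.\<close>
  define \<sigma> where "\<sigma> p = (if Ex (keeps p) then Eps (keeps p) else SOME y. y \<in> V - set p)" for p
  have "\<sigma> p \<in> V - set p" if "V - set p \<noteq> {}" for p
  proof (cases "Ex (keeps p)")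
    case True
    then have "keeps p (\<sigma> p)" by (simp add: \<sigma>_def someI_ex)
    then show ?thesis by (simp add: keeps_def)
  next
    case False
    then show ?thesis using some_in_eq[of "V - set p"] that by (auto simp: \<sigma>_def)
  qed
  then have valid: "valid_strategy K s Dominator \<sigma>"
    unfolding valid_strategy_def play_def complete_play_def V_def by blast
  have inv: "if mover s (length p) = Staller then secure N V (claimed s Dominator p) (V - set p)
      else answerable N V (claimed s Dominator p) (V - set p)"
    if "distinct p" "set p \<subseteq> V" "consistent s Dominator \<sigma> p" for p
    using that
  proof (induction p rule: rev_induct)
    case Nil
    have "secure N V {} V"
      unfolding secure_def using assms by (auto simp: N_def V_def)
    then show ?case
      using answerable_if_secure by (auto simp: claimed_def)
  next
    case (snoc x p)
    have diff: "V - set (p @ [x]) = V - set p - {x}" by auto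
    have IH: "if mover s (length p) = Staller then secure N V (claimed s Dominator p) (V - set p)
      else answerable N V (claimed s Dominator p) (V - set p)"
      using snoc by (auto simp: consistent_snoc)
    show ?case
    proof (cases "mover s (length p)")
      case Staller
      then show ?thesis
        using IH answerable_after_move unfolding diff by (simp add: claimed_snoc mover_Suc)
    next
      case Dominator
      \<comment> \<open>A vertex is still free, so \<open>answerable\<close> yields a move that
        restores \<open>secure\<close>.\<close>
      have "x \<in> V - set p" using snoc.prems by auto
      then have "Ex (keeps p)"
        using IH Dominator by (auto simp: answerable_def keeps_def split: if_splits)
      then have "keeps p (\<sigma> p)" by (simp add: \<sigma>_def someI_ex)
      moreover have "x = \<sigma> p" using snoc.prems Dominator by (simp add: consistent_snoc)
      ultimately show ?thesis
        using Dominator unfolding diff by (simp add: claimed_snoc mover_Suc keeps_def)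
    qed
  qed
  have "dominating_set K (claimed s Dominator p)"
    if "complete_play K p" "consistent s Dominator \<sigma> p" for p
  proof -
    have p: "distinct p" "set p = V" using that by (auto simp: complete_play_def V_def)
    then have "secure N V (claimed s Dominator p) {}"
      using inv[of p] that(2) by (auto simp: answerable_def split: if_splits)
    then have "\<forall>v\<in>V. N v \<inter> claimed s Dominator p \<noteq> {}"
      by (intro ballI secure_emptyD)
    moreover have "claimed s Dominator p \<subseteq> V"
      using p by (auto simp: claimed_def)
    ultimately show ?thesis
      by (fastforce simp: dominating_set_def V_def N_def closed_nbhd_def)
  qed
  then show ?thesis
    unfolding dominator_wins_def using valid by blast
qed

section \<open>Cutting path covers into short paths\<close>

text \<open>Two vertices are cut off the front as long as at least four remain, which ends with a
  piece of two or three.\<close>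

lemma path_cut_induct:
  assumes "distinct p" "2 \<le> length p" "set (vwalk_arcs p) \<subseteq> R"
    and edge: "\<And>a b. a \<noteq> b \<Longrightarrow> (a, b) \<in> R \<Longrightarrow> \<Phi> {a, b}"
    and path3: "\<And>a b c. distinct [a, b, c] \<Longrightarrow> (a, b) \<in> R \<Longrightarrow> (b, c) \<in> R \<Longrightarrow> \<Phi> {a, b, c}"
    and un: "\<And>X Y. X \<inter> Y = {} \<Longrightarrow> \<Phi> X \<Longrightarrow> \<Phi> Y \<Longrightarrow> \<Phi> (X \<union> Y)"
  shows "\<Phi> (set p)"
  using assms(1-3)
proof (induction p rule: length_induct)
  case (1 p)
  then obtain a b q where p: "p = a # b # q"
    by (cases p; cases "tl p") auto
  consider "q = []" | c where "q = [c]" | c d r where "q = c # d # r"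
    by (cases q; cases "tl q") auto
  then show ?case
  proof cases
    case 1
    then show ?thesis using edge[of a b] \<open>distinct p\<close> \<open>set (vwalk_arcs p) \<subseteq> R\<close> p by simp
  next
    case 2
    then show ?thesis using path3[of a b c] \<open>distinct p\<close> \<open>set (vwalk_arcs p) \<subseteq> R\<close> p by simp
  next
    case 3
    then have "\<Phi> (set q)"
      using "1.prems" "1.IH"[rule_format, of q] p by simp
    moreover have "\<Phi> {a, b}"
      using edge[of a b] "1.prems" p by simp
    moreover have "{a, b} \<inter> set q = {}" using "1.prems"(1) p by auto
    ultimately have "\<Phi> ({a, b} \<union> set q)" using un by blast
    then show ?thesis using p by simp
  qed
qed

lemma nontrivial_path_cover_induct [consumes 2, case_names empty edge path3 Un]:
  assumes "finite (pverts G)" "nontrivial_path_cover G C"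
    and empty: "\<Phi> {}"
    and edge: "\<And>a b. a \<noteq> b \<Longrightarrow> (a, b) \<in> parcs G \<Longrightarrow> \<Phi> {a, b}"
    and path3: "\<And>a b c. distinct [a, b, c] \<Longrightarrow> (a, b) \<in> parcs G \<Longrightarrow> (b, c) \<in> parcs G \<Longrightarrow> \<Phi> {a, b, c}"
    and un: "\<And>X Y. X \<inter> Y = {} \<Longrightarrow> \<Phi> X \<Longrightarrow> \<Phi> Y \<Longrightarrow> \<Phi> (X \<union> Y)"
  shows "\<Phi> (pverts G)"
proof -
  have paths: "is_path P" "parcs P \<noteq> {}" "parcs P \<subseteq> parcs G" if "P \<in> C" for P
    using assms(2) that
    by (auto simp: nontrivial_path_cover_def path_cover_def subgraph_def)
  have disj: "pverts P \<inter> pverts Q = {}" if "P \<in> C" "Q \<in> C" "P \<noteq> Q" for P Q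
    using assms(2) that by (auto simp: nontrivial_path_cover_def path_cover_def)
  have cover: "(\<Union>P\<in>C. pverts P) = pverts G"
    using assms(2) by (auto simp: nontrivial_path_cover_def path_cover_def)
  have nonempty: "pverts P \<noteq> {}" if "P \<in> C" for P
    using paths(1)[OF that] by (auto simp: is_path_def)
  \<comment> \<open>Finiteness of the cover has to be derived: its members have nonempty, pairwise
    disjoint vertex sets, all inside the finite set \<open>pverts G\<close>.\<close>
  have "inj_on pverts C"
    using disj nonempty by (metis inf.idem inj_onI)
  moreover have "finite (pverts ` C)"
    using assms(1) cover by (metis finite_UnionD)
  ultimately have fin: "finite C" using finite_imageD by blast
  have \<Phi>: "\<Phi> (pverts P)" if P: "P \<in> C" for P
  proof -
    from paths(1)[OF P] obtain p where p: "distinct p" "pverts P = set p"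
      "parcs P = set (vwalk_arcs p) \<union> (set (vwalk_arcs p))\<inverse>"
      by (auto simp: is_path_def)
    have "vwalk_arcs p \<noteq> []" using paths(2)[OF P] p(3) by auto
    then have "2 \<le> length p" by (cases p; cases "tl p") auto
    then show ?thesis
      unfolding p(2)
      by (rule path_cut_induct[OF p(1), where R = "parcs G"])
        (use paths(3)[OF P] p(3) edge path3 un in auto)
  qed
  have "\<Phi> (\<Union>P\<in>D. pverts P)" if "D \<subseteq> C" for D
    using finite_subset[OF that fin] that
  proof (induction D)
    case empty
    then show ?case using assms(3) by simp
  next
    case (insert P D)
    have "pverts P \<inter> (\<Union>Q\<in>D. pverts Q) = {}"
      using disj insert by blast
    then show ?case using un \<Phi> insert by simp
  qed
  then show ?thesis using cover by (metis order_refl)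
qed

section \<open>Cartesian products\<close>

theorem theorem3p2:
  fixes G :: "'a pair_pre_digraph" and H :: "'b pair_pre_digraph"
  assumes "pair_graph G" and "pair_graph H"
    and "\<exists>C. nontrivial_path_cover G C"
    and "\<exists>C. nontrivial_path_cover H C"
  shows "outcome_D (G \<box> H)"
proof -
  interpret G: pair_graph G by fact
  interpret H: pair_graph H by fact
  from assms(3,4) obtain C D where C: "nontrivial_path_cover G C" and D: "nontrivial_path_cover H D"
    by blast
  define N where "N = closed_nbhd (G \<box> H)"
  have symG: "(b, a) \<in> parcs G" if "(a, b) \<in> parcs G" for a b
    using G.pair_sym_arcs that by (auto simp: symmetric_def dest: symD)
  have symH: "(b, a) \<in> parcs H" if "(a, b) \<in> parcs H" for a b
    using H.pair_sym_arcs that by (auto simp: symmetric_def dest: symD)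
  have inN: "u \<in> N v \<longleftrightarrow> u = v \<or> (fst u, fst v) \<in> parcs G \<and> snd u = snd v \<and> snd v \<in> pverts H \<or>
      fst u = fst v \<and> fst v \<in> pverts G \<and> (snd u, snd v) \<in> parcs H" for u v
    by (cases u; cases v) (auto simp: N_def closed_nbhd_def cart_prod_def)
  have G_edge: "guards N ({a, b} \<times> {h}) ({a, b} \<times> {h})"
    if "a \<noteq> b" "(a, b) \<in> parcs G" "h \<in> pverts H" for a b h
    using guards_edge[of "(a, h)" "(b, h)" N] that symG[OF that(2)] by (simp add: inN)
  have H_edge: "guards N ({g} \<times> {d, e}) ({g} \<times> {d, e})"
    if "d \<noteq> e" "(d, e) \<in> parcs H" "g \<in> pverts G" for d e g
    using guards_edge[of "(g, d)" "(g, e)" N] that symH[OF that(2)] by (simp add: inN)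
  have Un_G: "guards N ((X \<union> Y) \<times> W) ((X \<union> Y) \<times> W)"
    if "X \<inter> Y = {}" "guards N (X \<times> W) (X \<times> W)" "guards N (Y \<times> W) (Y \<times> W)" for X Y W
    using guards_Un[OF that(2,3)] that(1) by (simp add: Sigma_Un_distrib1 Times_Int_Times)
  have Un_H: "guards N (W \<times> (X \<union> Y)) (W \<times> (X \<union> Y))"
    if "X \<inter> Y = {}" "guards N (W \<times> X) (W \<times> X)" "guards N (W \<times> Y) (W \<times> Y)" for X Y W
    using guards_Un[OF that(2,3)] that(1) by (simp add: Sigma_Un_distrib2 Times_Int_Times)
  \<comment> \<open>The copies of the edge \<open>ab\<close>, one for each \<open>h\<close> in
    \<open>Y\<close>, form a perfect matching.\<close>
  have G_row: "guards N ({a, b} \<times> Y) ({a, b} \<times> Y)"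
    if "a \<noteq> b" "(a, b) \<in> parcs G" "finite Y" "Y \<subseteq> pverts H" for a b Y
    using that(3,4)
  proof (induction Y)
    case empty
    then show ?case by (simp add: guards.empty)
  next
    case (insert h Y)
    then show ?case using Un_H[of "{h}" Y "{a, b}"] G_edge that(1,2) by simp
  qed
  \<comment> \<open>The cover of \<open>G\<close> is cut first, against all of
    \<open>pverts H\<close>. An edge of \<open>G\<close> is settled by \<open>G_row\<close>; only a
    three-vertex piece calls for cutting the cover of \<open>H\<close> as well.\<close>
  have "guards N (pverts G \<times> pverts H) (pverts G \<times> pverts H)"
    using G.pair_finite_verts C
  proof (induction rule: nontrivial_path_cover_induct)
    case empty
    then show ?case by (simp add: guards.empty)
  next
    case (edge a b)
    then show ?case using G_row H.pair_finite_verts by blast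
  next
    case (path3 a b c)
    then have abc: "a \<in> pverts G" "b \<in> pverts G" "c \<in> pverts G" "(b, a) \<in> parcs G" "(c, b) \<in> parcs G"
      by (auto dest: G.in_arcsD1 G.in_arcsD2 symG)
    show ?case
      using H.pair_finite_verts D
    proof (induction rule: nontrivial_path_cover_induct)
      case empty
      then show ?case by (simp add: guards.empty)
    next
      case (edge d e)
      \<comment> \<open>The three copies of the edge \<open>de\<close> form a perfect
        matching.\<close>
      then have "guards N (({a} \<union> ({b} \<union> {c})) \<times> {d, e}) (({a} \<union> ({b} \<union> {c})) \<times> {d, e})"
        using path3(1) abc by (intro Un_G H_edge) auto
      moreover have "{a} \<union> ({b} \<union> {c}) = {a, b, c}" by blast
      ultimately show ?case by (simp only:)
    next
      case (path3 d e f)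
      have "d \<in> pverts H" "e \<in> pverts H" "f \<in> pverts H" "(e, d) \<in> parcs H" "(f, e) \<in> parcs H"
        using path3 by (auto dest: H.in_arcsD1 H.in_arcsD2 symH)
      \<comment> \<open>Row by row numbering, with \<open>d\<close>, \<open>e\<close>,
        \<open>f\<close> indexing the rows and \<open>a\<close>, \<open>b\<close>, \<open>c\<close>
        the columns.\<close>
      then have "guards N
          {(a, d), (b, d), (c, d), (a, e), (b, e), (c, e), (a, f), (b, f), (c, f)}
          {(a, d), (b, d), (c, d), (a, e), (b, e), (c, e), (a, f), (b, f), (c, f)}"
        using abc path3 \<open>distinct [a, b, c]\<close> \<open>(a, b) \<in> parcs G\<close> \<open>(b, c) \<in> parcs G\<close>
        by (intro guards_grid_3x3) (simp_all add: inN)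
      moreover have "{a, b, c} \<times> {d, e, f} =
          {(a, d), (b, d), (c, d), (a, e), (b, e), (c, e), (a, f), (b, f), (c, f)}"
        by blast
      ultimately show ?case by simp
    next
      case (Un X Y)
      then show ?case by (rule Un_H)
    qed
  next
    case (Un X Y)
    then show ?case by (rule Un_G)
  qed
  then show ?thesis
    unfolding outcome_D_def using dominator_wins_if_guards[of "G \<box> H"]
    by (simp add: N_def cart_prod_def)
qed

end
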